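(* Let $0<\gamma<1$, $0<\alpha<1$, $x_A>0$, and let $T=(x_T,y_T)$ be a point lying outside the $DA$ Apollonius circle (the circle with center $(a,0)$ and radius $r_A$, $a=\frac{1+\gamma^2}{1-\gamma^2}x_A$, $r_A=\frac{2\gamma}{1-\gamma^2}x_A$). The optimal interception point $I=(x_I,y_I)$, i.e. the point of the $DA$ Apollonius circle that minimizes $$J(x_I,y_I)=\sqrt{(x_I-x_T)^2+(y_I-y_T)^2}+\alpha\sqrt{(x_A-x_I)^2+y_I^2}$$ subject to $(a-x_I)^2+y_I^2=r_A^2$, has polar coordinates $I=(\varphi^*,r_A)$ (angle, radius) with respect to the center of the $DA$ Apollonius circle, where $\varphi^*$ is the solution of the sixth order complex exponential equation \begin{align*} &\frac{Nr_A}{l}\Big(1-\frac{N}{\alpha^2Ml}\Big)e^{6i\varphi} +\Big(\Big(\frac{N}{\alpha Ml}\Big)^2(r_A^2+M^2)-r_A^2-N^2\Big)e^{5i\varphi}\\ &+Nr_A\Big(\frac{N}{\alpha^2Ml^2}(2l^2-1)+l-\frac{2}{l}\Big)e^{4i\varphi} +2\Big(r_A^2+N^2-\Big(\frac{N}{\alpha M}\Big)^2(r_A^2+M^2)\Big)e^{3i\varphi}\\ &+Nr_A\Big(\frac{N}{\alpha^2M}(2-l^2)-2l+\frac{1}{l}\Big)e^{2i\varphi} +\Big(\Big(\frac{Nl}{\alpha M}\Big)^2(r_A^2+M^2)-r_A^2-N^2\Big)e^{i\varphi}\\ &+Nr_Al\Big(1-\frac{Nl}{\alpha^2M}\Big)=0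 \end{align*} that minimizes the cost $$J(\varphi)=\sqrt{r_A^2+N^2-2Nr_A\cos(\varphi-\lambda)}+\alpha\sqrt{r_A^2+M^2-2Mr_A\cos\varphi},$$ where $l=e^{i\lambda}$, $M=\frac{2\gamma^2}{1-\gamma^2}x_A$ is the distance between the points $A=(x_A,0)$ and $(a,0)$, and $N=\sqrt{(a-x_T)^2+y_T^2}$ is the distance between the points $(a,0)$ and $T$.
   Context: Planar pursuit-evasion setting: a Target $T$, an Attacker $A$ and a Defender $D$ move with constant speeds $V_T,V_A,V_D$; $\alpha=V_T/V_A\in(0,1)$ and $\gamma=V_A/V_D\in(0,1)$. In a Cartesian frame their initial positions are $T=(x_T,y_T)$, $A=(x_A,0)$, $D=(-x_A,0)$ with $x_A>0$. The $DA$ Apollonius circle is the set of points $P$ with $|PA|=\gamma|PD|$, i.e. the circle with center $(a,0)$ and radius $r_A$, where $a=\frac{1+\gamma^2}{1-\gamma^2}x_A$ and $r_A=\frac{2\gamma}{1-\gamma^2}x_A$. The Defender intercepts the Attacker at a point $I$ of this circle. The center $(a,0)$ is also denoted by $a$. Polar angle convention: angles at the center $(a,0)$ are measured from the ray going from $(a,0)$ towards $A$ (the negative $X$-direction), with positive angles towards positive $y$. Thus the point with polar coordinates $(\varphi,r_A)$ is $I=(a-r_A\cos\varphi,\ r_A\sin\varphi)$, and $\lambda$ is the polar angle of the Target, i.e. $T=(a-N\cos\lambda,\ N\sin\lambda)$. The angle $\varphi$ is real. *)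

theory Defs
  imports "HOL-Analysis.Analysis"
begin

text \<open>The Attacker starts at \<open>(x\<^sub>A, 0)\<close> and the Defender at \<open>(- x\<^sub>A, 0)\<close>; \<open>\<gamma>\<close> is the speed ratio
  Attacker/Defender and \<open>\<alpha>\<close> the speed ratio Target/Attacker.\<close>

definition center_x :: "real \<Rightarrow> real \<Rightarrow> real" where
  "center_x \<gamma> x\<^sub>A = (1 + \<gamma>\<^sup>2) / (1 - \<gamma>\<^sup>2) * x\<^sub>A"

definition apollonius_radius :: "real \<Rightarrow> real \<Rightarrow> real" where
  "apollonius_radius \<gamma> x\<^sub>A = 2 * \<gamma> / (1 - \<gamma>\<^sup>2) * x\<^sub>A"

definition apollonius_circle :: "real \<Rightarrow> real \<Rightarrow> (real \<times> real) set" where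
  "apollonius_circle \<gamma> x\<^sub>A = sphere (center_x \<gamma> x\<^sub>A, 0) (apollonius_radius \<gamma> x\<^sub>A)"

definition attacker_dist :: "real \<Rightarrow> real \<Rightarrow> real" where
  "attacker_dist \<gamma> x\<^sub>A = 2 * \<gamma>\<^sup>2 / (1 - \<gamma>\<^sup>2) * x\<^sub>A"

definition target_dist :: "real \<Rightarrow> real \<Rightarrow> real \<times> real \<Rightarrow> real" where
  "target_dist \<gamma> x\<^sub>A T = sqrt ((center_x \<gamma> x\<^sub>A - fst T)\<^sup>2 + (snd T)\<^sup>2)"

text \<open>Polar angles are measured from the negative \<open>x\<close>-direction, positive towards positive \<open>y\<close>
  (hence clockwise).\<close>

definition polar_point :: "real \<Rightarrow> real \<Rightarrow> real \<Rightarrow> real \<Rightarrow> real \<times> real" where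
  "polar_point \<gamma> x\<^sub>A \<phi> \<rho> = (center_x \<gamma> x\<^sub>A - \<rho> * cos \<phi>, \<rho> * sin \<phi>)"

definition cost :: "real \<Rightarrow> real \<Rightarrow> real \<times> real \<Rightarrow> real \<times> real \<Rightarrow> real" where
  "cost \<alpha> x\<^sub>A T I =
     sqrt ((fst I - fst T)\<^sup>2 + (snd I - snd T)\<^sup>2) + \<alpha> * sqrt ((x\<^sub>A - fst I)\<^sup>2 + (snd I)\<^sup>2)"

definition polar_cost :: "real \<Rightarrow> real \<Rightarrow> real \<Rightarrow> real \<Rightarrow> real \<Rightarrow> real \<Rightarrow> real" where
  "polar_cost \<alpha> r M N lam \<phi> =
     sqrt (r\<^sup>2 + N\<^sup>2 - 2 * N * r * cos (\<phi> - lam)) + \<alpha> * sqrt (r\<^sup>2 + M\<^sup>2 - 2 * M * r * cos \<phi>)"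

text \<open>The parameters other than \<open>\<phi>\<close> have type \<^typ>\<open>complex\<close> only to avoid coercions in the formula:
  \<open>\<alpha>\<close>, \<open>r\<close>, \<open>M\<close>, \<open>N\<close> stand for real quantities and \<open>l\<close> for \<open>exp (\<i> * lam)\<close>, with \<open>lam\<close> the polar angle
  of the Target.\<close>

definition sextic :: "complex \<Rightarrow> complex \<Rightarrow> complex \<Rightarrow> complex \<Rightarrow> complex \<Rightarrow> real \<Rightarrow> complex" where
  "sextic \<alpha> r M N l \<phi> =
      N * r / l * (1 - N / (\<alpha>\<^sup>2 * M * l)) * exp (6 * \<i> * of_real \<phi>)
    + ((N / (\<alpha> * M * l))\<^sup>2 * (r\<^sup>2 + M\<^sup>2) - r\<^sup>2 - N\<^sup>2) * exp (5 * \<i> * of_real \<phi>)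
    + N * r * (N / (\<alpha>\<^sup>2 * M * l\<^sup>2) * (2 * l\<^sup>2 - 1) + l - 2 / l) * exp (4 * \<i> * of_real \<phi>)
    + 2 * (r\<^sup>2 + N\<^sup>2 - (N / (\<alpha> * M))\<^sup>2 * (r\<^sup>2 + M\<^sup>2)) * exp (3 * \<i> * of_real \<phi>)
    + N * r * (N / (\<alpha>\<^sup>2 * M) * (2 - l\<^sup>2) - 2 * l + 1 / l) * exp (2 * \<i> * of_real \<phi>)
    + ((N * l / (\<alpha> * M))\<^sup>2 * (r\<^sup>2 + M\<^sup>2) - r\<^sup>2 - N\<^sup>2) * exp (\<i> * of_real \<phi>)
    + N * r * l * (1 - N * l / (\<alpha>\<^sup>2 * M))"

lemma apollonius_circle_eq_locus:
  assumes "0 < \<gamma>" "\<gamma> < 1" "0 < x\<^sub>A"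
  shows "apollonius_circle \<gamma> x\<^sub>A = {P. dist P (x\<^sub>A, 0) = \<gamma> * dist P (- x\<^sub>A, 0)}"
proof -
  have g: "1 - \<gamma>\<^sup>2 > 0"
    using assms by (simp add: power_less_one_iff abs_square_less_1)
  have r: "apollonius_radius \<gamma> x\<^sub>A \<ge> 0"
    using assms g by (simp add: apollonius_radius_def)
  have "(x, y) \<in> apollonius_circle \<gamma> x\<^sub>A \<longleftrightarrow> dist (x, y) (x\<^sub>A, 0) = \<gamma> * dist (x, y) (- x\<^sub>A, 0)" for x y
  proof -
    define c where "c = center_x \<gamma> x\<^sub>A"
    define \<rho> where "\<rho> = apollonius_radius \<gamma> x\<^sub>A"
    have c: "(1 - \<gamma>\<^sup>2) * c = (1 + \<gamma>\<^sup>2) * x\<^sub>A"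
      using g by (simp add: c_def center_x_def)
    have "c\<^sup>2 - \<rho>\<^sup>2 = (((1 + \<gamma>\<^sup>2) * x\<^sub>A)\<^sup>2 - (2 * \<gamma> * x\<^sub>A)\<^sup>2) / (1 - \<gamma>\<^sup>2)\<^sup>2"
      by (simp add: c_def \<rho>_def center_x_def apollonius_radius_def power_divide power_mult_distrib
          diff_divide_distrib)
    also have "((1 + \<gamma>\<^sup>2) * x\<^sub>A)\<^sup>2 - (2 * \<gamma> * x\<^sub>A)\<^sup>2 = x\<^sub>A\<^sup>2 * (1 - \<gamma>\<^sup>2)\<^sup>2"
      by algebra
    finally have cr: "c\<^sup>2 - \<rho>\<^sup>2 = x\<^sub>A\<^sup>2"
      using g by simp
    have id: "(x - x\<^sub>A)\<^sup>2 + y\<^sup>2 - \<gamma>\<^sup>2 * ((x + x\<^sub>A)\<^sup>2 + y\<^sup>2) = (1 - \<gamma>\<^sup>2) * ((x - c)\<^sup>2 + y\<^sup>2 - \<rho>\<^sup>2)"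
      using c cr by algebra
    have "dist (x, y) (x\<^sub>A, 0) = \<gamma> * dist (x, y) (- x\<^sub>A, 0)
        \<longleftrightarrow> (x - x\<^sub>A)\<^sup>2 + y\<^sup>2 = \<gamma>\<^sup>2 * ((x + x\<^sub>A)\<^sup>2 + y\<^sup>2)"
      using assms
        power_eq_iff_eq_base[of 2 "dist (x, y) (x\<^sub>A, 0)" "\<gamma> * dist (x, y) (- x\<^sub>A, 0)"]
      by (simp add: dist_Pair_Pair dist_real_def power_mult_distrib)
    also have "\<dots> \<longleftrightarrow> (x - c)\<^sup>2 + y\<^sup>2 = \<rho>\<^sup>2"
      using id g by (metis cancel_comm_monoid_add_class.diff_cancel eq_iff_diff_eq_0
          less_irrefl mult_eq_0_iff)
    also have "\<dots> \<longleftrightarrow> (x, y) \<in> apollonius_circle \<gamma> x\<^sub>A"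
      using r power_eq_iff_eq_base[of 2 "dist (c, 0) (x, y)" \<rho>]
      by (simp add: apollonius_circle_def c_def \<rho>_def dist_Pair_Pair dist_real_def power2_commute)
    finally show ?thesis by simp
  qed
  then show ?thesis by auto
qed

lemma attacker_dist_eq:
  assumes "0 < \<gamma>" "\<gamma> < 1" "0 < x\<^sub>A"
  shows "attacker_dist \<gamma> x\<^sub>A = dist (x\<^sub>A, 0::real) (center_x \<gamma> x\<^sub>A, 0)"
proof -
  have g: "1 - \<gamma>\<^sup>2 > 0"
    using assms by (simp add: abs_square_less_1)
  have "center_x \<gamma> x\<^sub>A - x\<^sub>A = attacker_dist \<gamma> x\<^sub>A"
    using g by (simp add: center_x_def attacker_dist_def field_simps)
  moreover have "attacker_dist \<gamma> x\<^sub>A \<ge> 0"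
    using assms g by (simp add: attacker_dist_def)
  ultimately show ?thesis
    by (simp add: dist_Pair_Pair dist_real_def)
qed

end

theory Submission imports Defs begin

text \<open>
  Writing \<open>s\<close> for the derivative of the distance to a fixed point along the circle (the sine of the
  angle at \<open>I\<close> between the radius and the line to that point), the critical points of the polar cost
  are the solutions of \<open>s\<^sub>T + \<alpha> s\<^sub>A = 0\<close>; squaring this equation and passing to
  exponentials gives the sextic, so a global minimizer solves it. For uniqueness, a minimizer \<open>I\<close> must be
  visible from \<open>T\<close>: otherwise the other intersection of the line \<open>IT\<close> with the circle is cheaper by the
  triangle inequality, as \<open>\<alpha> < 1\<close>. On the visible arc \<open>arcsin s\<^sub>T + arcsin (\<alpha> s\<^sub>A)\<close> is
  strictly increasing, because its first summand has slope greater than \<open>1\<close> and its second one slope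
  greater than \<open>-1\<close>; hence it has at most one zero.
\<close>

section \<open>Distance from a circle point to a fixed point, and its slope along the circle\<close>

text \<open>By the law of cosines, the distance between a point at radius \<open>r\<close> and a
  point at radius \<open>N\<close> whose directions from the center differ by the angle
  \<open>t\<close>.\<close>

definition chord :: "real \<Rightarrow> real \<Rightarrow> real \<Rightarrow> real" where
  "chord r N t = sqrt (r\<^sup>2 + N\<^sup>2 - 2 * N * r * cos t)"

text \<open>The angular derivative of \<open>chord\<close> divided by \<open>r\<close>, i.e. its
  derivative with respect to arc length.\<close>

definition chord_slope :: "real \<Rightarrow> real \<Rightarrow> real \<Rightarrow> real" where
  "chord_slope r N t = N * sin t / chord r N t"

text \<open>Assuming \<open>r \<noteq> N\<close> rather than an order lets the same facts serve the
  Target outside the circle and the Attacker inside it.\<close>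

lemma chord_arg_pos:
  fixes r N t :: real
  assumes "0 < r" "0 < N" "r \<noteq> N"
  shows "0 < r\<^sup>2 + N\<^sup>2 - 2 * N * r * cos t"
proof -
  have "0 < (r - N)\<^sup>2" using assms by simp
  moreover have "0 \<le> 2 * N * r * (1 - cos t)" using assms by simp
  moreover have "r\<^sup>2 + N\<^sup>2 - 2 * N * r * cos t = (r - N)\<^sup>2 + 2 * N * r * (1 - cos t)"
    by algebra
  ultimately show ?thesis by linarith
qed

lemma chord_pos: "0 < r \<Longrightarrow> 0 < N \<Longrightarrow> r \<noteq> N \<Longrightarrow> 0 < chord r N t"
  using chord_arg_pos by (simp add: chord_def)

lemma chord_square:
  "0 < r \<Longrightarrow> 0 < N \<Longrightarrow> r \<noteq> N \<Longrightarrow> (chord r N t)\<^sup>2 = r\<^sup>2 + N\<^sup>2 - 2 * N * r * cos t"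
  using chord_arg_pos[of r N t] by (simp add: chord_def)

lemma has_derivative_chord:
  assumes "0 < r" "0 < N" "r \<noteq> N"
  shows "((\<lambda>x. chord r N (x - c)) has_real_derivative r * chord_slope r N (x - c)) (at x)"
  unfolding chord_def chord_slope_def
  using chord_arg_pos[OF assms, of "x - c"]
  by (auto intro!: derivative_eq_intros simp: field_simps)

text \<open>Pythagoras for the vector from the circle point to the fixed point: its radial component
  is \<open>N * cos t - r\<close> and, up to sign, its tangential one is \<open>N * sin t\<close>.
  So the right-hand side is the squared cosine of the angle whose sine is
  \<open>chord_slope\<close>; its base is positive exactly when the circle point is strictly
  visible.\<close>

lemma chord_slope_cos:
  assumes "0 < r" "0 < N" "r \<noteq> N"
  shows "1 - (chord_slope r N t)\<^sup>2 = ((N * cos t - r) / chord r N t)\<^sup>2"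
proof -
  have "(chord r N t)\<^sup>2 - (N * sin t)\<^sup>2 = (N * cos t - r)\<^sup>2"
    unfolding chord_square[OF assms] using sin_cos_squared_add[of t] by algebra
  moreover have "1 - (chord_slope r N t)\<^sup>2 = ((chord r N t)\<^sup>2 - (N * sin t)\<^sup>2) / (chord r N t)\<^sup>2"
    using chord_pos[OF assms, of t]
    by (simp add: chord_slope_def power_divide diff_divide_distrib)
  ultimately show ?thesis by (simp add: power_divide)
qed

text \<open>The derivative is kept as a product: the cosine of the angle at the circle point times
  the rate of change of that angle. Composing with \<open>arcsin\<close> cancels the cosine up to
  sign.\<close>

lemma has_derivative_chord_slope:
  assumes "0 < r" "0 < N" "r \<noteq> N"
  shows "((\<lambda>x. chord_slope r N (x - c)) has_real_derivative
    (N * cos (x - c) - r) / chord r N (x - c) * (N * (N - r * cos (x - c)) / (chord r N (x - c))\<^sup>2)) (at x)"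
proof -
  define d where "d = chord r N (x - c)"
  have d: "d > 0" using chord_pos[OF assms] by (simp add: d_def)
  have d2: "d\<^sup>2 = r\<^sup>2 + N\<^sup>2 - 2 * N * r * cos (x - c)"
    using chord_square[OF assms] by (simp add: d_def)
  have "((\<lambda>x. chord_slope r N (x - c)) has_real_derivative
      (N * cos (x - c) * d - N * sin (x - c) * (r * (N * sin (x - c) / d))) / (d * d)) (at x)"
    unfolding chord_slope_def d_def
    using has_derivative_chord[OF assms, of c x] d
    by (auto intro!: derivative_eq_intros simp: d_def chord_slope_def)
  moreover have "(N * cos (x - c) * d - N * sin (x - c) * (r * (N * sin (x - c) / d))) / (d * d) =
      (N * cos (x - c) * d\<^sup>2 - r * (N * sin (x - c))\<^sup>2) / d ^ 3"
    using d by (simp add: field_simps power2_eq_square power3_eq_cube)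
  moreover have "N * cos (x - c) * d\<^sup>2 - r * (N * sin (x - c))\<^sup>2 = (N * cos (x - c) - r) * (N * (N - r * cos (x - c)))"
    unfolding d2 using sin_cos_squared_add[of "x - c"] by algebra
  ultimately show ?thesis
    by (simp add: d_def power3_eq_cube power2_eq_square mult.assoc)
qed

section \<open>Critical points of the polar cost\<close>

lemma polar_cost_chord: "polar_cost \<alpha> r M N lam \<phi> = chord r N (\<phi> - lam) + \<alpha> * chord r M \<phi>"
  by (simp add: polar_cost_def chord_def)

lemma polar_cost_min_critical:
  assumes "0 < r" "0 < N" "r \<noteq> N" "0 < M" "r \<noteq> M"
    and min: "\<And>\<psi>. polar_cost \<alpha> r M N lam \<phi> \<le> polar_cost \<alpha> r M N lam \<psi>"
  shows "chord_slope r N (\<phi> - lam) + \<alpha> * chord_slope r M \<phi> = 0"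
proof -
  have "(polar_cost \<alpha> r M N lam has_real_derivative
      r * (chord_slope r N (\<phi> - lam) + \<alpha> * chord_slope r M \<phi>)) (at \<phi>)"
    unfolding polar_cost_chord[abs_def]
    using has_derivative_chord[of r N lam \<phi>] has_derivative_chord[of r M 0 \<phi>] assms
    by (auto intro!: derivative_eq_intros simp: algebra_simps)
  then have "r * (chord_slope r N (\<phi> - lam) + \<alpha> * chord_slope r M \<phi>) = 0"
    using min by (intro DERIV_local_min[of _ _ _ 1]) auto
  then show ?thesis using assms by simp
qed

section \<open>Monotonicity of the arcsine sum and uniqueness of visible critical points\<close>

lemma chord_slope_bound:
  assumes "0 < r" "0 < M" "r \<noteq> M"
  shows "\<bar>chord_slope r M t\<bar> \<le> 1"
proof -
  have "(chord_slope r M t)\<^sup>2 \<le> 1"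
    using chord_slope_cos[OF assms, of t]
    by (metis diff_ge_0_iff_ge zero_le_power2)
  then show ?thesis by (simp add: abs_square_le_1)
qed

text \<open>Visibility makes the cosine \<open>C\<close> positive, so \<open>arcsin\<close> recovers
  the angle itself and the derivative is its rate \<open>K\<close>. The numerator of
  \<open>K\<close> exceeds \<open>d\<^sup>2\<close> by \<open>r * (N * cos (x - c) - r)\<close>,
  which is positive.\<close>

lemma arcsin_chord_slope_deriv:
  assumes "0 < r" "r < N" "N * cos (x - c) > r"
  shows "\<exists>D>1. ((\<lambda>x. arcsin (chord_slope r N (x - c))) has_real_derivative D) (at x)"
proof -
  have a: "0 < r" "0 < N" "r \<noteq> N" using assms by auto
  define d where "d = chord r N (x - c)"
  have d: "d > 0" and d2: "d\<^sup>2 = r\<^sup>2 + N\<^sup>2 - 2 * N * r * cos (x - c)"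
    using chord_pos[OF a] chord_square[OF a] by (auto simp: d_def)
  define C where "C = (N * cos (x - c) - r) / d"
  have C: "C > 0" using assms d by (simp add: C_def)
  have sC: "1 - (chord_slope r N (x - c))\<^sup>2 = C\<^sup>2"
    using chord_slope_cos[OF a] by (simp add: C_def d_def)
  then have "(chord_slope r N (x - c))\<^sup>2 < 1" using C by (smt (verit) zero_less_power)
  then have b: "\<bar>chord_slope r N (x - c)\<bar> < 1" by (simp add: abs_square_less_1)
  define K where "K = N * (N - r * cos (x - c)) / d\<^sup>2"
  have "r * r < r * (N * cos (x - c))" using assms by simp
  then have "d\<^sup>2 < N * (N - r * cos (x - c))"
    unfolding d2 by (simp add: power2_eq_square algebra_simps)
  then have K: "K > 1" using d by (simp add: K_def)
  have "((\<lambda>x. chord_slope r N (x - c)) has_real_derivative C * K) (at x)"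
    using has_derivative_chord_slope[OF a, of c x] by (simp add: C_def K_def d_def)
  then have "((\<lambda>x. arcsin (chord_slope r N (x - c))) has_real_derivative
      inverse (sqrt (1 - (chord_slope r N (x - c))\<^sup>2)) * (C * K)) (at x)"
    using b by (intro DERIV_chain2[OF DERIV_arcsin]) auto
  moreover have "inverse (sqrt (1 - (chord_slope r N (x - c))\<^sup>2)) * (C * K) = K"
    unfolding sC using C by simp
  ultimately show ?thesis using K by auto
qed

text \<open>The derivative is \<open>R * K\<close>, where \<open>K\<close> is the rate of the
  unscaled angle and \<open>R\<close> is the damping caused by \<alpha>. Since
  \<open>K + 1 = r * (r - M * cos x) / d\<^sup>2\<close> is positive and \<open>0 < R < 1\<close>,
  the product stays above \<open>-R\<close>, hence above \<open>-1\<close>.\<close>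

lemma arcsin_scaled_chord_slope_deriv:
  assumes "0 < M" "M < r" "0 < \<alpha>" "\<alpha> < 1"
  shows "\<exists>D>-1. ((\<lambda>x. arcsin (\<alpha> * chord_slope r M x)) has_real_derivative D) (at x)"
proof -
  have a: "0 < r" "0 < M" "r \<noteq> M" using assms by auto
  define d where "d = chord r M x"
  have d: "d > 0" and d2: "d\<^sup>2 = r\<^sup>2 + M\<^sup>2 - 2 * M * r * cos x"
    using chord_pos[OF a] chord_square[OF a] by (auto simp: d_def)
  define s where "s = chord_slope r M x"
  define C where "C = (r - M * cos x) / d"
  have "M * cos x \<le> M" using a cos_le_one[of x] by simp
  then have Mc: "M * cos x < r" using assms by linarith
  then have C: "C > 0" using d by (simp add: C_def)
  have sC: "1 - s\<^sup>2 = C\<^sup>2"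
    using chord_slope_cos[OF a, of x] by (simp add: C_def d_def s_def power_divide power2_commute)
  have s1: "\<bar>s\<bar> \<le> 1" using chord_slope_bound[OF a] by (simp add: s_def)
  have b: "\<bar>\<alpha> * s\<bar> < 1"
    using mult_left_le[OF s1, of \<alpha>] assms unfolding abs_mult by linarith
  have "\<alpha>\<^sup>2 \<le> 1" using assms by (simp add: abs_square_le_1)
  then have "(\<alpha> * s)\<^sup>2 \<le> s\<^sup>2"
    by (simp add: power_mult_distrib mult_left_le_one_le)
  then have "C\<^sup>2 \<le> 1 - (\<alpha> * s)\<^sup>2" using sC by simp
  then have CS: "C \<le> sqrt (1 - (\<alpha> * s)\<^sup>2)" by (rule real_le_rsqrt)
  \<comment> \<open>\<open>C\<close> is the cosine belonging to \<open>s\<close> and the root is the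
    cosine belonging to \<open>\<alpha> * s\<close>; shrinking the sine cannot shrink the cosine, so
    the quotient is at most \<open>\<alpha>\<close>.\<close>
  define R where "R = \<alpha> * C / sqrt (1 - (\<alpha> * s)\<^sup>2)"
  have "\<alpha> * C < sqrt (1 - (\<alpha> * s)\<^sup>2)" using CS C assms
    by (smt (verit) mult_less_cancel_right2)
  moreover have "0 < sqrt (1 - (\<alpha> * s)\<^sup>2)" using C CS by linarith
  ultimately have R: "0 < R" "R < 1" using C \<open>0 < \<alpha>\<close> unfolding R_def by simp_all
  define K where "K = M * (r * cos x - M) / d\<^sup>2"
  have "0 < r * (r - M * cos x)" using Mc assms by simp
  then have "- (d\<^sup>2) < M * (r * cos x - M)"
    unfolding d2 by (simp add: power2_eq_square algebra_simps)
  then have K: "K > -1" using d by (simp add: K_def field_simps)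
  have "((\<lambda>x. chord_slope r M x) has_real_derivative
      (M * cos x - r) / d * (M * (M - r * cos x) / d\<^sup>2)) (at x)"
    using has_derivative_chord_slope[OF a, of 0 x] by (simp add: d_def)
  \<comment> \<open>For a point inside the circle the radial component is negative, so both factors
    change sign to make the cosine \<open>C\<close> positive.\<close>
  also have "(M * cos x - r) / d * (M * (M - r * cos x) / d\<^sup>2) = C * K"
    using d by (simp add: C_def K_def field_simps)
  finally have "((\<lambda>x. \<alpha> * chord_slope r M x) has_real_derivative \<alpha> * (C * K)) (at x)"
    by (rule DERIV_cmult)
  then have "((\<lambda>x. arcsin (\<alpha> * chord_slope r M x)) has_real_derivative
      inverse (sqrt (1 - (\<alpha> * chord_slope r M x)\<^sup>2)) * (\<alpha> * (C * K))) (at x)"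
    using b by (intro DERIV_chain2[OF DERIV_arcsin]) (auto simp: s_def)
  moreover have "inverse (sqrt (1 - (\<alpha> * chord_slope r M x)\<^sup>2)) * (\<alpha> * (C * K)) = R * K"
    by (simp add: R_def s_def field_simps)
  moreover have "R * K > -1"
  proof -
    have "R * (K + 1) > 0" using R K by simp
    then show ?thesis using R by (simp add: algebra_simps)
  qed
  ultimately show ?thesis by auto
qed

text \<open>The two angles are taken in one period window centered at \<open>lam\<close>, so that
  the whole interval between them stays on the visible arc, where the arcsine sum increases
  strictly.\<close>

lemma critical_unique:
  assumes r: "0 < M" "M < r" "r < N" and \<alpha>: "0 < \<alpha>" "\<alpha> < 1"
    and crit: "\<And>\<phi>. \<phi> \<in> {p, q} \<Longrightarrow> chord_slope r N (\<phi> - lam) + \<alpha> * chord_slope r M \<phi> = 0"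
    and vis: "r < N * cos (p - lam)" "r < N * cos (q - lam)"
    and range: "p - lam \<in> {-pi..pi}" "q - lam \<in> {-pi..pi}"
  shows "\<not> p < q"
proof
  assume "p < q"
  define F where "F x = arcsin (chord_slope r N (x - lam)) + arcsin (\<alpha> * chord_slope r M x)" for x
  have F0: "F \<phi> = 0" if "\<phi> \<in> {p, q}" for \<phi>
  proof -
    have "\<bar>chord_slope r N (\<phi> - lam)\<bar> \<le> 1"
      using r by (intro chord_slope_bound) auto
    moreover have "\<alpha> * chord_slope r M \<phi> = - chord_slope r N (\<phi> - lam)"
      using crit[OF that] by simp
    ultimately show ?thesis by (simp add: F_def arcsin_minus)
  qed
  have "F p < F q"
  proof (rule DERIV_pos_imp_increasing[OF \<open>p < q\<close>])
    fix x assume x: "p \<le> x" "x \<le> q"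
    \<comment> \<open>Cosine rises on \<open>[-pi, 0]\<close> and falls on \<open>[0, pi]\<close>,
      so \<open>x\<close> is at least as visible as the endpoint on its side of
      \<open>lam\<close>.\<close>
    have "r < N * cos (x - lam)"
    proof (cases "x \<le> lam")
      case True
      then have "cos (p - lam) \<le> cos (x - lam)"
        using x range cos_monotone_0_pi_le[of "lam - x" "lam - p"]
        by (simp flip: cos_minus[of "p - lam"] cos_minus[of "x - lam"])
      then show ?thesis using vis r mult_left_mono[of "cos (p - lam)" "cos (x - lam)" N] by linarith
    next
      case False
      then have "cos (q - lam) \<le> cos (x - lam)"
        using x range cos_monotone_0_pi_le[of "x - lam" "q - lam"] by simp
      then show ?thesis using vis r mult_left_mono[of "cos (q - lam)" "cos (x - lam)" N] by linarith
    qed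
    then obtain D where D: "D > 1"
        "((\<lambda>x. arcsin (chord_slope r N (x - lam))) has_real_derivative D) (at x)"
      using arcsin_chord_slope_deriv r by (meson less_trans)
    obtain E where E: "E > -1"
        "((\<lambda>x. arcsin (\<alpha> * chord_slope r M x)) has_real_derivative E) (at x)"
      using arcsin_scaled_chord_slope_deriv r \<alpha> by blast
    have "(F has_real_derivative D + E) (at x)"
      unfolding F_def[abs_def] by (intro DERIV_add D E)
    then show "\<exists>y. (F has_real_derivative y) (at x) \<and> 0 < y" using D E by (intro exI[of _ "D + E"]) auto
  qed
  then show False using F0 by simp
qed

section \<open>Visibility of minimizers from the Target\<close>

text \<open>If \<open>T\<close> were strictly behind the tangent hyperplane at \<open>I\<close>,
  moving along the chord towards \<open>T\<close> would save its full length in the first term and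
  cost at most \<alpha> times that length in the second. Tangency is not excluded here.\<close>

lemma min_on_sphere_visible:
  fixes A T I c :: "'a :: real_inner"
  assumes "0 \<le> r" and T: "r < dist c T" and I: "I \<in> sphere c r" and \<alpha>: "0 < \<alpha>" "\<alpha> < 1"
    and min: "\<And>P. P \<in> sphere c r \<Longrightarrow> dist I T + \<alpha> * dist A I \<le> dist P T + \<alpha> * dist A P"
  shows "0 \<le> (I - c) \<bullet> (T - I)"
proof (rule ccontr)
  assume neg: "\<not> ?thesis"
  define u where "u = I - c"
  define v where "v = T - I"
  have u: "u \<bullet> u = r\<^sup>2"
    using I by (simp add: u_def dist_norm norm_minus_commute dot_square_norm)
  have "r\<^sup>2 < (dist c T)\<^sup>2"
    using T assms by (simp add: power_strict_mono)
  also have "(dist c T)\<^sup>2 = (u + v) \<bullet> (u + v)"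
    by (simp add: u_def v_def dist_norm norm_minus_commute dot_square_norm)
  finally have uv: "0 < v \<bullet> v + 2 * (u \<bullet> v)"
    using u by (simp add: inner_add inner_commute)
  have n: "u \<bullet> v < 0" using neg by (simp add: u_def v_def)
  then have v: "0 < v \<bullet> v" using uv by linarith
  \<comment> \<open>\<open>I + t v\<close> is the other intersection of the line \<open>IT\<close> with the sphere.\<close>
  define t where "t = - 2 * (u \<bullet> v) / (v \<bullet> v)"
  \<comment> \<open>\<open>t < 1\<close> is the condition that \<open>T\<close> lies outside the
    sphere; it places the second intersection strictly between \<open>I\<close> and
    \<open>T\<close>.\<close>
  have t: "0 < t" "t < 1" using n uv v by (auto simp: t_def field_simps)
  define P where "P = I + t *\<^sub>R v"
  have tv: "t * (v \<bullet> v) = - 2 * (u \<bullet> v)" using v by (simp add: t_def)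
  have "(u + t *\<^sub>R v) \<bullet> (u + t *\<^sub>R v) = u \<bullet> u + t * (2 * (u \<bullet> v) + t * (v \<bullet> v))"
    by (simp add: inner_add inner_commute algebra_simps)
  also have "\<dots> = r\<^sup>2" using tv u by simp
  finally have "(norm (u + t *\<^sub>R v))\<^sup>2 = r\<^sup>2" by (simp add: dot_square_norm)
  moreover have "u + t *\<^sub>R v = P - c" by (simp add: P_def u_def)
  ultimately have "P \<in> sphere c r"
    using assms(1) by (simp add: dist_norm norm_minus_commute)
  then have le: "dist I T + \<alpha> * dist A I \<le> dist P T + \<alpha> * dist A P" by (rule min)
  have "P - T = - ((1 - t) *\<^sub>R v)" by (simp add: P_def v_def algebra_simps)
  then have PT: "dist P T = (1 - t) * norm v" using t by (simp add: dist_norm)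
  have IT: "dist I T = norm v" by (simp add: v_def dist_norm norm_minus_commute)
  have "dist I P = t * norm v" using t by (simp add: P_def dist_norm)
  then have "\<alpha> * dist A P \<le> \<alpha> * (dist A I + t * norm v)"
    using \<alpha> dist_triangle[of A P I] by simp
  then have "t * norm v \<le> \<alpha> * (t * norm v)" using le PT IT by (simp add: algebra_simps)
  moreover have "0 < t * norm v" using t v by auto
  ultimately have "1 \<le> \<alpha>" using mult_less_cancel_right2[of \<alpha> "t * norm v"] by linarith
  then show False using \<alpha> by simp
qed

section \<open>From the critical equation to the sextic\<close>

text \<open>The real expression is the difference of the squared sides of the critical equation
  after clearing denominators. Euler's formulas turn it into a Laurent polynomial in
  \<open>exp (\<i> * \<phi>)\<close>; the factor 4 comes from the squared sines, and the third power
  removes the negative exponents.\<close>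

lemma sextic_identity:
  fixes r M N \<alpha> lam \<phi> :: real
  assumes "\<alpha> \<noteq> 0" "M \<noteq> 0"
  shows "(\<alpha> * M)\<^sup>2 * sextic \<alpha> r M N (exp (\<i> * lam)) \<phi> = 4 * exp (\<i> * \<phi>) ^ 3 *
    complex_of_real ((\<alpha> * M * sin \<phi>)\<^sup>2 * (r\<^sup>2 + N\<^sup>2 - 2 * N * r * cos (\<phi> - lam))
      - (N * sin (\<phi> - lam))\<^sup>2 * (r\<^sup>2 + M\<^sup>2 - 2 * M * r * cos \<phi>))"
proof -
  define z where "z = exp (\<i> * complex_of_real \<phi>)"
  define l where "l = exp (\<i> * complex_of_real lam)"
  have nz: "z \<noteq> 0" "l \<noteq> 0" by (auto simp: z_def l_def)
  have e: "exp (of_nat n * \<i> * complex_of_real \<phi>) = z ^ n" for n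
    unfolding z_def by (subst exp_of_nat_mult[symmetric]) (simp add: mult.assoc)
  have es: "exp (6 * \<i> * complex_of_real \<phi>) = z ^ 6" "exp (5 * \<i> * complex_of_real \<phi>) = z ^ 5"
    "exp (4 * \<i> * complex_of_real \<phi>) = z ^ 4" "exp (3 * \<i> * complex_of_real \<phi>) = z ^ 3"
    "exp (2 * \<i> * complex_of_real \<phi>) = z ^ 2"
    using e[of 6] e[of 5] e[of 4] e[of 3] e[of 2] by simp_all
  have zl: "exp (\<i> * complex_of_real (\<phi> - lam)) = z / l"
    by (simp add: z_def l_def exp_diff right_diff_distrib)
  have zi: "exp (- (\<i> * complex_of_real \<phi>)) = 1 / z"
    and zli: "exp (- (\<i> * complex_of_real (\<phi> - lam))) = l / z"
    unfolding exp_minus zl by (simp_all add: z_def inverse_eq_divide)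
  have c: "2 * complex_of_real (cos \<phi>) = z + 1 / z"
    using zi by (simp add: cos_of_real[symmetric] cos_exp_eq z_def)
  have c': "2 * complex_of_real (cos (\<phi> - lam)) = z / l + l / z"
    unfolding cos_of_real[symmetric] cos_exp_eq zl zli by (simp add: mult.commute)
  have s: "2 * \<i> * complex_of_real (sin \<phi>) = z - 1 / z"
    using zi by (simp add: sin_of_real[symmetric] sin_exp_eq z_def)
  have s': "2 * \<i> * complex_of_real (sin (\<phi> - lam)) = z / l - l / z"
    unfolding sin_of_real[symmetric] sin_exp_eq zl zli by simp
  have "(2 * \<i> * complex_of_real x)\<^sup>2 = - 4 * (complex_of_real x)\<^sup>2" for x
    by (simp add: power_mult_distrib)
  then have sq: "4 * (complex_of_real (sin \<phi>))\<^sup>2 = - (z - 1 / z)\<^sup>2"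
    "4 * (complex_of_real (sin (\<phi> - lam)))\<^sup>2 = - (z / l - l / z)\<^sup>2"
    using s s' by (metis minus_minus mult_minus_left)+
  have "4 * complex_of_real ((\<alpha> * M * sin \<phi>)\<^sup>2 * (r\<^sup>2 + N\<^sup>2 - 2 * N * r * cos (\<phi> - lam))
      - (N * sin (\<phi> - lam))\<^sup>2 * (r\<^sup>2 + M\<^sup>2 - 2 * M * r * cos \<phi>)) =
     (complex_of_real \<alpha> * M)\<^sup>2 * (4 * (complex_of_real (sin \<phi>))\<^sup>2)
        * (r\<^sup>2 + N\<^sup>2 - N * r * (2 * complex_of_real (cos (\<phi> - lam))))
      - N\<^sup>2 * (4 * (complex_of_real (sin (\<phi> - lam)))\<^sup>2)
        * (r\<^sup>2 + M\<^sup>2 - M * r * (2 * complex_of_real (cos \<phi>)))"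
    by (simp add: power_mult_distrib algebra_simps)
  also have "\<dots> = N\<^sup>2 * (z / l - l / z)\<^sup>2 * (r\<^sup>2 + M\<^sup>2 - M * r * (z + 1 / z))
      - (complex_of_real \<alpha> * M)\<^sup>2 * (z - 1 / z)\<^sup>2 * (r\<^sup>2 + N\<^sup>2 - N * r * (z / l + l / z))"
    unfolding sq c c' by simp
  finally have *: "4 * complex_of_real ((\<alpha> * M * sin \<phi>)\<^sup>2 * (r\<^sup>2 + N\<^sup>2 - 2 * N * r * cos (\<phi> - lam))
      - (N * sin (\<phi> - lam))\<^sup>2 * (r\<^sup>2 + M\<^sup>2 - 2 * M * r * cos \<phi>)) = \<dots>" .
  define a m n \<rho> where "a = complex_of_real \<alpha>" and "m = complex_of_real M"
    and "n = complex_of_real N" and "\<rho> = complex_of_real r"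
  have nz': "a \<noteq> 0" "m \<noteq> 0" using assms by (auto simp: a_def m_def)
  \<comment> \<open>Treating the inverse of \<open>l\<close> as a separate variable makes both sides
    polynomial; the relation \<open>l * k = 1\<close> is then needed only for the cross term of a
    square.\<close>
  define k where "k = 1 / l"
  have "(a * m)\<^sup>2 * sextic a \<rho> m n l \<phi> =
      ((a * m)\<^sup>2 * (n * \<rho> * k) - n\<^sup>2 * m * \<rho> * k\<^sup>2) * z ^ 6
    + (n\<^sup>2 * k\<^sup>2 * (\<rho>\<^sup>2 + m\<^sup>2) - (a * m)\<^sup>2 * (\<rho>\<^sup>2 + n\<^sup>2)) * z ^ 5
    + (n\<^sup>2 * m * \<rho> * (2 - k\<^sup>2) + (a * m)\<^sup>2 * (n * \<rho> * (l - 2 * k))) * z ^ 4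
    + 2 * ((a * m)\<^sup>2 * (\<rho>\<^sup>2 + n\<^sup>2) - n\<^sup>2 * (\<rho>\<^sup>2 + m\<^sup>2)) * z ^ 3
    + (n\<^sup>2 * m * \<rho> * (2 - l\<^sup>2) + (a * m)\<^sup>2 * (n * \<rho> * (k - 2 * l))) * z ^ 2
    + (n\<^sup>2 * l\<^sup>2 * (\<rho>\<^sup>2 + m\<^sup>2) - (a * m)\<^sup>2 * (\<rho>\<^sup>2 + n\<^sup>2)) * z
    + ((a * m)\<^sup>2 * (n * \<rho> * l) - n\<^sup>2 * m * \<rho> * l\<^sup>2)"
    (is "_ = ?c6 * z ^ 6 + ?c5 * z ^ 5 + ?c4 * z ^ 4 + ?c3 * z ^ 3 + ?c2 * z ^ 2 + ?c1 * z + ?c0")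
  proof -
    have "(a * m)\<^sup>2 * (n * \<rho> / l * (1 - n / (a\<^sup>2 * m * l))) = ?c6"
      using nz nz' by (simp add: k_def field_simps power2_eq_square)
    moreover have "(a * m)\<^sup>2 * ((n / (a * m * l))\<^sup>2 * (\<rho>\<^sup>2 + m\<^sup>2) - \<rho>\<^sup>2 - n\<^sup>2) = ?c5"
      using nz nz' by (simp add: k_def field_simps power2_eq_square)
    moreover have "(a * m)\<^sup>2 * (n * \<rho> * (n / (a\<^sup>2 * m * l\<^sup>2) * (2 * l\<^sup>2 - 1) + l - 2 / l)) = ?c4"
      using nz nz' by (simp add: k_def field_simps power2_eq_square)
    moreover have "(a * m)\<^sup>2 * (2 * (\<rho>\<^sup>2 + n\<^sup>2 - (n / (a * m))\<^sup>2 * (\<rho>\<^sup>2 + m\<^sup>2))) = ?c3"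
      using nz nz' by (simp add: field_simps power2_eq_square)
    moreover have "(a * m)\<^sup>2 * (n * \<rho> * (n / (a\<^sup>2 * m) * (2 - l\<^sup>2) - 2 * l + 1 / l)) = ?c2"
      using nz nz' by (simp add: k_def field_simps power2_eq_square)
    moreover have "(a * m)\<^sup>2 * ((n * l / (a * m))\<^sup>2 * (\<rho>\<^sup>2 + m\<^sup>2) - \<rho>\<^sup>2 - n\<^sup>2) = ?c1"
      using nz nz' by (simp add: field_simps power2_eq_square)
    moreover have "(a * m)\<^sup>2 * (n * \<rho> * l * (1 - n * l / (a\<^sup>2 * m))) = ?c0"
      using nz nz' by (simp add: field_simps power2_eq_square)
    ultimately show ?thesis
      unfolding sextic_def es z_def[symmetric]
      by (simp only: distrib_left mult.assoc[symmetric])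
  qed
  also have "\<dots> = n\<^sup>2 * (z\<^sup>2 * k - l)\<^sup>2 * ((\<rho>\<^sup>2 + m\<^sup>2) * z - m * \<rho> * (z\<^sup>2 + 1))
      - (a * m)\<^sup>2 * (z\<^sup>2 - 1)\<^sup>2 * ((\<rho>\<^sup>2 + n\<^sup>2) * z - n * \<rho> * (z\<^sup>2 * k + l))"
  proof -
    have "l * k = 1" using nz by (simp add: k_def)
    then have "(z\<^sup>2 * k - l)\<^sup>2 = z ^ 4 * k\<^sup>2 - 2 * z\<^sup>2 + l\<^sup>2" by algebra
    then show ?thesis by algebra
  qed
  also have "\<dots> = z ^ 3 * (n\<^sup>2 * (z / l - l / z)\<^sup>2 * (\<rho>\<^sup>2 + m\<^sup>2 - m * \<rho> * (z + 1 / z))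
      - (a * m)\<^sup>2 * (z - 1 / z)\<^sup>2 * (\<rho>\<^sup>2 + n\<^sup>2 - n * \<rho> * (z / l + l / z)))"
  proof -
    have fs: "z\<^sup>2 * k - l = z * (z / l - l / z)" "z\<^sup>2 - 1 = z * (z - 1 / z)"
        "z\<^sup>2 + 1 = z * (z + 1 / z)" "z\<^sup>2 * k + l = z * (z / l + l / z)"
      using nz by (simp_all add: k_def distrib_left right_diff_distrib power2_eq_square)
    show ?thesis
      unfolding fs by (simp only: right_diff_distrib power_mult_distrib power2_eq_square power3_eq_cube mult_ac)
  qed
  finally have "(a * m)\<^sup>2 * sextic a \<rho> m n l \<phi> = \<dots>" .
  then show ?thesis
    using * unfolding l_def z_def a_def m_def n_def \<rho>_def
    by (simp add: mult.assoc mult.left_commute)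
qed

text \<open>Squaring loses the relative sign of the two slopes, so the sextic also vanishes where
  they balance with the wrong sign; hence only an implication.\<close>

lemma critical_imp_sextic:
  assumes "0 < r" "0 < N" "r \<noteq> N" "0 < M" "r \<noteq> M" "\<alpha> \<noteq> 0"
    and crit: "chord_slope r N (\<phi> - lam) + \<alpha> * chord_slope r M \<phi> = 0"
  shows "sextic \<alpha> r M N (exp (\<i> * complex_of_real lam)) \<phi> = 0"
proof -
  define d e where "d = chord r N (\<phi> - lam)" and "e = chord r M \<phi>"
  have pos: "d > 0" "e > 0" using assms chord_pos by (auto simp: d_def e_def)
  have sq: "r\<^sup>2 + N\<^sup>2 - 2 * N * r * cos (\<phi> - lam) = d\<^sup>2" "r\<^sup>2 + M\<^sup>2 - 2 * M * r * cos \<phi> = e\<^sup>2"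
    using assms chord_square by (simp_all add: d_def e_def)
  have "N * sin (\<phi> - lam) / d + \<alpha> * (M * sin \<phi> / e) = 0"
    using crit by (simp add: chord_slope_def d_def e_def)
  then have "N * sin (\<phi> - lam) * e = - (\<alpha> * M * sin \<phi> * d)"
    using pos by (simp add: field_simps)
  then have "(N * sin (\<phi> - lam) * e)\<^sup>2 = (\<alpha> * M * sin \<phi> * d)\<^sup>2" by simp
  then have "(\<alpha> * M * sin \<phi>)\<^sup>2 * d\<^sup>2 - (N * sin (\<phi> - lam))\<^sup>2 * e\<^sup>2 = 0"
    by (simp add: power_mult_distrib)
  then show ?thesis
    using sextic_identity[of \<alpha> M r N lam \<phi>] assms unfolding sq by simp
qed

section \<open>Passage between points of the circle and their angles\<close>

theorem theorem1:
  fixes \<gamma> \<alpha> x\<^sub>A lam :: real and T :: "real \<times> real"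
  defines "r \<equiv> apollonius_radius \<gamma> x\<^sub>A"
    and "M \<equiv> attacker_dist \<gamma> x\<^sub>A"
    and "N \<equiv> target_dist \<gamma> x\<^sub>A T"
    and "l \<equiv> exp (\<i> * complex_of_real lam)"
  assumes "0 < \<gamma>" and "\<gamma> < 1" and "0 < \<alpha>" and "\<alpha> < 1" and "0 < x\<^sub>A"
    and outside: "T \<notin> cball (center_x \<gamma> x\<^sub>A, 0) r"
    and angle: "T = polar_point \<gamma> x\<^sub>A lam N"
  shows "(\<exists>!I. is_arg_min (cost \<alpha> x\<^sub>A T) (\<lambda>P. P \<in> apollonius_circle \<gamma> x\<^sub>A) I) \<and>
    (\<forall>I. is_arg_min (cost \<alpha> x\<^sub>A T) (\<lambda>P. P \<in> apollonius_circle \<gamma> x\<^sub>A) I \<longleftrightarrow>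
      (\<exists>\<phi>. is_arg_min (polar_cost \<alpha> r M N lam) (\<lambda>\<phi>. sextic \<alpha> r M N l \<phi> = 0) \<phi> \<and>
           I = polar_point \<gamma> x\<^sub>A \<phi> r))"
proof -
  define c where "c = center_x \<gamma> x\<^sub>A"
  define S where "S = apollonius_circle \<gamma> x\<^sub>A"
  define Q where "Q \<phi> = polar_point \<gamma> x\<^sub>A \<phi> r" for \<phi>
  let ?J = "cost \<alpha> x\<^sub>A T" and ?K = "polar_cost \<alpha> r M N lam"
  let ?min = "\<lambda>\<phi>. \<forall>\<psi>. ?K \<phi> \<le> ?K \<psi>"
  have g: "1 - \<gamma>\<^sup>2 > 0"
    using assms by (simp add: abs_square_less_1)
  have r: "r > 0" using assms g by (simp add: r_def apollonius_radius_def)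
  have Mr: "M = \<gamma> * r" by (simp add: M_def r_def attacker_dist_def apollonius_radius_def power2_eq_square)
  have M: "0 < M" "M < r" unfolding Mr using r \<open>0 < \<gamma>\<close> \<open>\<gamma> < 1\<close> by simp_all
  have N_dist: "N = dist (c, 0) T"
    by (cases T) (simp add: N_def target_dist_def dist_Pair_Pair dist_real_def c_def)
  then have N: "r < N" using outside by (simp add: c_def)
  \<comment> \<open>The Attacker has polar angle 0 and radius \<open>M\<close>, so its distance to a
    circle point is also given by the law of cosines.\<close>
  have xA: "x\<^sub>A = c - M"
  proof -
    have "c - M = ((1 + \<gamma>\<^sup>2) - 2 * \<gamma>\<^sup>2) / (1 - \<gamma>\<^sup>2) * x\<^sub>A"
      by (simp only: c_def M_def center_x_def attacker_dist_def diff_divide_distrib left_diff_distrib)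
    then show ?thesis using g by simp
  qed
  have Q_eq: "Q \<phi> = (c - r * cos \<phi>, r * sin \<phi>)" for \<phi>
    by (simp add: Q_def polar_point_def c_def)
  have cost_Q: "?J (Q \<phi>) = ?K \<phi>" for \<phi>
  proof -
    have e1: "(fst (Q \<phi>) - fst T)\<^sup>2 + (snd (Q \<phi>) - snd T)\<^sup>2 = r\<^sup>2 + N\<^sup>2 - 2 * N * r * cos (\<phi> - lam)"
      unfolding Q_def by (subst (1 2) angle)
        (simp add: polar_point_def cos_diff, use sin_cos_squared_add[of \<phi>] sin_cos_squared_add[of lam] in algebra)
    have e2: "(x\<^sub>A - fst (Q \<phi>))\<^sup>2 + (snd (Q \<phi>))\<^sup>2 = r\<^sup>2 + M\<^sup>2 - 2 * M * r * cos \<phi>"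
      unfolding Q_eq fst_conv snd_conv using xA sin_cos_squared_add[of \<phi>] by algebra
    show ?thesis unfolding cost_def polar_cost_def e1 e2 ..
  qed
  have S: "S = sphere (c, 0) r" by (simp add: S_def apollonius_circle_def c_def r_def)
  have S_eq: "S = range Q"
  proof (intro equalityI subsetI)
    fix P assume "P \<in> S"
    then have "(c - fst P)\<^sup>2 + (snd P)\<^sup>2 = r\<^sup>2"
      by (cases P) (auto simp: S dist_Pair_Pair dist_real_def)
    then have "((c - fst P) / r)\<^sup>2 + (snd P / r)\<^sup>2 = 1"
      using r by (simp add: power_divide flip: add_divide_distrib)
    then obtain t where "(c - fst P) / r = cos t" "snd P / r = sin t"
      using sincos_total_2pi by metis
    then have "P = Q t"
      using r by (auto simp: Q_eq prod_eq_iff field_simps)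
    then show "P \<in> range Q" by simp
  next
    fix P assume "P \<in> range Q"
    then obtain t where "P = Q t" by auto
    then show "P \<in> S"
      using r by (simp add: S Q_eq dist_Pair_Pair dist_real_def power_mult_distrib flip: distrib_left)
  qed
  have arg_min_iff: "is_arg_min ?J (\<lambda>P. P \<in> S) I \<longleftrightarrow> (\<exists>\<phi>. ?min \<phi> \<and> I = Q \<phi>)" for I
  proof -
    have "is_arg_min ?J (\<lambda>P. P \<in> S) I \<longleftrightarrow> I \<in> range Q \<and> (\<forall>P\<in>range Q. ?J I \<le> ?J P)"
      unfolding is_arg_min_linorder S_eq by blast
    also have "\<dots> \<longleftrightarrow> (\<exists>\<phi>. (\<forall>\<psi>. ?J (Q \<phi>) \<le> ?J (Q \<psi>)) \<and> I = Q \<phi>)"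
      by blast
    also have "\<dots> \<longleftrightarrow> (\<exists>\<phi>. ?min \<phi> \<and> I = Q \<phi>)"
      unfolding cost_Q ..
    finally show ?thesis .
  qed
  have min_critical: "chord_slope r N (\<phi> - lam) + \<alpha> * chord_slope r M \<phi> = 0" if "?min \<phi>" for \<phi>
    using that r N M by (intro polar_cost_min_critical) auto
  have min_sextic: "sextic \<alpha> r M N l \<phi> = 0" if "?min \<phi>" for \<phi>
    unfolding l_def using r N M \<open>0 < \<alpha>\<close>
    by (intro critical_imp_sextic min_critical[OF that]) auto
  \<comment> \<open>Compactness is available on the circle, not on the line of angles, so the
    minimum is found there and pulled back.\<close>
  have ex: "\<exists>\<phi>. ?min \<phi>"
  proof -
    have "continuous_on S ?J"
      unfolding cost_def[abs_def] by (intro continuous_intros)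
    moreover have "compact S" by (simp add: S)
    moreover have "S \<noteq> {}" by (simp add: S_eq)
    ultimately obtain I where "I \<in> S" "\<forall>P\<in>S. ?J I \<le> ?J P"
      using continuous_attains_inf by blast
    then have "is_arg_min ?J (\<lambda>P. P \<in> S) I"
      unfolding is_arg_min_linorder by blast
    then show ?thesis unfolding arg_min_iff by blast
  qed
  have visible: "r < N * cos (\<phi> - lam)" if "?min \<phi>" for \<phi>
  proof -
    have J_dist: "?J P = dist P T + \<alpha> * dist (x\<^sub>A, 0) P" for P
      by (cases P; cases T) (simp add: cost_def dist_Pair_Pair dist_real_def)
    have "0 \<le> (Q \<phi> - (c, 0)) \<bullet> (T - Q \<phi>)"
    proof (rule min_on_sphere_visible[where r = r and \<alpha> = \<alpha> and A = "(x\<^sub>A, 0)"])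
      fix P :: "real \<times> real" assume "P \<in> sphere (c, 0) r"
      then show "dist (Q \<phi>) T + \<alpha> * dist (x\<^sub>A, 0) (Q \<phi>) \<le> dist P T + \<alpha> * dist (x\<^sub>A, 0) P"
        using that unfolding J_dist[symmetric] S[symmetric] S_eq by (auto simp: cost_Q)
    qed (use r N N_dist \<open>0 < \<alpha>\<close> \<open>\<alpha> < 1\<close> in \<open>auto simp flip: S simp: S_eq\<close>)
    also have "(Q \<phi> - (c, 0)) \<bullet> (T - Q \<phi>) = r * (N * cos (\<phi> - lam) - r)"
      unfolding Q_def by (subst angle)
        (simp add: polar_point_def cos_diff flip: c_def, use sin_cos_squared_add[of \<phi>] in algebra)
    finally have le: "r \<le> N * cos (\<phi> - lam)" using r by (simp add: zero_le_mult_iff)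
    \<comment> \<open>At a tangency point the slope of the distance to \<open>T\<close> is \<open>\<plusminus>1\<close>, too steep to be balanced.\<close>
    moreover have "r \<noteq> N * cos (\<phi> - lam)"
    proof
      assume eq: "r = N * cos (\<phi> - lam)"
      have "1 - (chord_slope r N (\<phi> - lam))\<^sup>2 = 0"
        using chord_slope_cos[of r N "\<phi> - lam"] r N by (simp flip: eq)
      then have "\<bar>chord_slope r N (\<phi> - lam)\<bar> = 1"
        by (simp add: abs_square_eq_1)
      then have "\<bar>\<alpha> * chord_slope r M \<phi>\<bar> = 1" using min_critical[OF that] by linarith
      moreover have "\<bar>chord_slope r M \<phi>\<bar> \<le> 1" using r M by (intro chord_slope_bound) auto
      ultimately show False
        using mult_left_le[of "\<bar>chord_slope r M \<phi>\<bar>" \<alpha>] \<open>0 < \<alpha>\<close> \<open>\<alpha> < 1\<close>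
        unfolding abs_mult by linarith
    qed
    ultimately show ?thesis by simp
  qed
  \<comment> \<open>Angles of the same point differ by full turns; a representative within
    \<open>pi\<close> of \<open>lam\<close> is what \<open>critical_unique\<close> asks for.\<close>
  have shift: "\<exists>p. ?min p \<and> Q p = Q \<phi> \<and> p - lam \<in> {-pi..pi}" if "?min \<phi>" for \<phi>
  proof -
    obtain t where t: "-pi \<le> t" "t \<le> pi" "sin (\<phi> - lam) = sin t" "cos (\<phi> - lam) = cos t"
      using sincos_principal_value[of "\<phi> - lam"] by (metis less_imp_le)
    define p where "p = t + lam"
    have "sin p = sin (\<phi> - lam + lam)" "cos p = cos (\<phi> - lam + lam)"
      unfolding p_def sin_add cos_add t(3,4) by (rule refl)+
    then have "Q p = Q \<phi>" by (simp add: Q_eq)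
    moreover from this have "?min p" using that by (metis cost_Q)
    ultimately show ?thesis using t by (auto simp: p_def)
  qed
  have uniq: "Q \<phi> = Q \<psi>" if \<phi>: "?min \<phi>" and \<psi>: "?min \<psi>" for \<phi> \<psi>
  proof -
    obtain p where p: "?min p" "Q p = Q \<phi>" "p - lam \<in> {-pi..pi}" using shift[OF \<phi>] by blast
    obtain q where q: "?min q" "Q q = Q \<psi>" "q - lam \<in> {-pi..pi}" using shift[OF \<psi>] by blast
    have "\<not> p < q"
      by (rule critical_unique[OF M N \<open>0 < \<alpha>\<close> \<open>\<alpha> < 1\<close>, of p q lam])
        (use p q min_critical visible in auto)
    moreover have "\<not> q < p"
      by (rule critical_unique[OF M N \<open>0 < \<alpha>\<close> \<open>\<alpha> < 1\<close>, of q p lam])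
        (use p q min_critical visible in auto)
    ultimately show ?thesis using p q by (metis linorder_less_linear)
  qed
  \<comment> \<open>Global minimizers exist and are all roots, so the least cost over the roots is
    the global least cost. This discards the spurious roots introduced by squaring.\<close>
  have polar_iff: "is_arg_min ?K (\<lambda>\<phi>. sextic \<alpha> r M N l \<phi> = 0) \<phi> \<longleftrightarrow> ?min \<phi>" for \<phi>
    unfolding is_arg_min_linorder using ex min_sextic by (meson order_trans)
  have "\<exists>!I. is_arg_min ?J (\<lambda>P. P \<in> S) I"
    unfolding arg_min_iff using ex uniq by metis
  moreover have "is_arg_min ?J (\<lambda>P. P \<in> S) I \<longleftrightarrow>
      (\<exists>\<phi>. is_arg_min ?K (\<lambda>\<phi>. sextic \<alpha> r M N l \<phi> = 0) \<phi> \<and> I = Q \<phi>)" for I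
    unfolding arg_min_iff polar_iff ..
  ultimately show ?thesis unfolding S_def Q_def by blast
qed

end
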